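(* Let $G$ be a finite group of order at least $2$. Then $\alpha(G)=0$ if and only if $G$ is a cyclic group of order $2$.
   Context: A subset $D$ of a group $G$ is a determining set of $G$ if the only automorphism of $G$ that fixes every element of $D$ is the identity automorphism (equivalently, every automorphism of $G$ is uniquely determined by its action on $D$). The determining number $\alpha(G)$ is the cardinality of a smallest determining set of $G$; if $G$ has only the identity automorphism then $\alpha(G)=0$. *)

theory Defs
  imports "HOL-Algebra.Bij" "HOL-Algebra.Elementary_Groups"
begin

text \<open>
  The elements of \<open>auto G\<close> are extensional, so the identity automorphism is the
  restriction of the identity to the carrier.
\<close>

definition determining_set :: "('a, 'b) monoid_scheme \<Rightarrow> 'a set \<Rightarrow> bool"
  where "determining_set G D \<longleftrightarrow>
    D \<subseteq> carrier G \<and>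
    (\<forall>\<phi> \<in> auto G. (\<forall>x \<in> D. \<phi> x = x) \<longrightarrow> \<phi> = (\<lambda>x \<in> carrier G. x))"

text \<open>
  Only finite determining sets are counted, since \<open>card\<close> is \<open>0\<close> on infinite sets.
  The number is meaningful only if a finite determining set exists, which is
  always the case when \<open>G\<close> is finite.
\<close>

definition determining_number :: "('a, 'b) monoid_scheme \<Rightarrow> nat"
  where "determining_number G =
    (LEAST n. \<exists>D. finite D \<and> determining_set G D \<and> card D = n)"

lemma determining_set_iff_unique:
  assumes "group G"
  shows "determining_set G D \<longleftrightarrow>
    D \<subseteq> carrier G \<and>
    (\<forall>\<phi> \<in> auto G. \<forall>\<psi> \<in> auto G. (\<forall>x \<in> D. \<phi> x = \<psi> x) \<longrightarrow> \<phi> = \<psi>)"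
    (is "_ \<longleftrightarrow> _ \<and> ?U")
proof -
  interpret group G by (rule assms)
  let ?e = "\<lambda>x \<in> carrier G. x"
  have "?U" if D: "determining_set G D"
  proof (intro ballI impI)
    fix \<phi> \<psi> assume h: "\<phi> \<in> auto G" "\<psi> \<in> auto G" and eq: "\<forall>x \<in> D. \<phi> x = \<psi> x"
    from D have DG: "D \<subseteq> carrier G" by (simp add: determining_set_def)
    let ?inv = "\<lambda>x \<in> carrier G. inv_into (carrier G) \<psi> x"
    have B: "\<phi> \<in> Bij (carrier G)" "\<psi> \<in> Bij (carrier G)" "\<phi> \<in> hom G G" "\<psi> \<in> hom G G"
      using h by (auto simp: auto_def)
    have inv: "?inv \<in> hom G G" "?inv \<in> Bij (carrier G)"
      using restrict_inv_into_hom[OF B(4,2)] restrict_inv_into_Bij[OF B(2)] by auto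
    let ?c = "compose (carrier G) ?inv \<phi>"
    have "?c \<in> auto G"
      using hom_compose[OF B(3) inv(1)] compose_Bij[OF inv(2) B(1)] by (simp add: auto_def)
    moreover have "?c x = x" if "x \<in> D" for x
    proof -
      have x: "x \<in> carrier G" using that DG by blast
      have "\<psi> x \<in> carrier G" "inj_on \<psi> (carrier G)"
        using x B(2) Bij_imp_funcset[OF B(2)] by (auto simp: Bij_def bij_betw_def)
      then show ?thesis using x eq that by (simp add: compose_def)
    qed
    ultimately have c: "?c = ?e" using D by (auto simp: determining_set_def)
    show "\<phi> = \<psi>"
    proof (rule extensionalityI[OF Bij_imp_extensional[OF B(1)] Bij_imp_extensional[OF B(2)]])
      fix x assume x: "x \<in> carrier G"
      have px: "\<phi> x \<in> \<psi> ` carrier G"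
        using x B(2) Bij_imp_funcset[OF B(1)] by (auto simp: Bij_def bij_betw_def)
      have "inv_into (carrier G) \<psi> (\<phi> x) = x"
        using fun_cong[OF c, of x] x funcset_mem[OF Bij_imp_funcset[OF B(1)] x]
        by (simp add: compose_def)
      then show "\<phi> x = \<psi> x" using f_inv_into_f[OF px] by simp
    qed
  qed
  moreover have "determining_set G D" if "D \<subseteq> carrier G" "?U"
    unfolding determining_set_def
  proof (intro conjI ballI impI)
    show "D \<subseteq> carrier G" by fact
  next
    fix \<phi> assume "\<phi> \<in> auto G" "\<forall>x \<in> D. \<phi> x = x"
    then show "\<phi> = ?e" using that id_in_auto by (metis restrict_apply' subsetD)
  qed
  ultimately show ?thesis by (auto simp: determining_set_def)
qed

lemma determining_set_carrier: "determining_set G (carrier G)"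
  by (auto simp: determining_set_def auto_def Bij_def intro!: extensionalityI)

lemma determining_number_attained:
  assumes "finite (carrier G)"
  shows "\<exists>D. finite D \<and> determining_set G D \<and> card D = determining_number G"
  unfolding determining_number_def
  by (rule LeastI_ex) (use assms determining_set_carrier in blast)

lemma determining_number_trivial:
  assumes "auto G = {\<lambda>x \<in> carrier G. x}"
  shows "determining_number G = 0"
proof -
  have "determining_set G {}" using assms by (simp add: determining_set_def)
  then show ?thesis unfolding determining_number_def
    by (intro Least_eq_0) (auto intro!: exI[of _ "{}"])
qed

end

theory Submission
  imports Defs
begin

text \<open>
  Since the empty set is the only finite set of cardinality \<open>0\<close>, the determining number
  vanishes exactly when the automorphism group is trivial
  (\<open>determining_number_eq_0_iff\<close>).  So the claim is that the group of order \<open>2\<close> is the only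
  nontrivial finite group without nontrivial automorphisms.

  A group of order \<open>2\<close> has no room for another automorphism: one of its two elements is the
  identity element, which stays fixed, and hence so does the other.  It is cyclic because
  the other element generates it.

  Conversely, a rigid group, one whose only automorphism is the identity, is abelian because all conjugations are trivial, and then
  satisfies \<open>x \<otimes> x = \<one>\<close> because inversion, now an automorphism, is trivial.  Such a
  group is a vector space over the field with two elements, and its nontrivial linear
  automorphisms are visible as transvections: take a hyperplane \<open>H\<close>, which in group terms
  is a maximal proper subgroup, and translate its complement by a fixed element of \<open>H\<close>.
  This automorphism is nontrivial unless that element is \<open>\<one>\<close>.  Rigidity
  therefore forces \<open>H = {\<one>}\<close>, and since \<open>H\<close> has index \<open>2\<close>, the group has
  order \<open>2\<close>.
\<close>

lemma determining_number_eq_0_iff: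
  assumes "finite (carrier G)"
  shows "determining_number G = 0 \<longleftrightarrow> determining_set G {}"
proof
  assume "determining_number G = 0"
  then show "determining_set G {}"
    using determining_number_attained[OF assms] by auto
next
  assume "determining_set G {}"
  then show "determining_number G = 0"
    unfolding determining_number_def by (intro Least_eq_0 exI[of _ "{}"]) auto
qed

text \<open>
  Rigidity in the form in which it is used: giving a two-sided inverse avoids handling
  injectivity, surjectivity and extensionality for each automorphism separately.
\<close>

lemma (in group) rigid_imp_fixes:
  assumes rigid: "determining_set G {}"
    and f: "f \<in> hom G G"
    and g: "g \<in> carrier G \<rightarrow> carrier G"
    and gf: "\<And>x. x \<in> carrier G \<Longrightarrow> g (f x) = x"
    and fg: "\<And>x. x \<in> carrier G \<Longrightarrow> f (g x) = x"
    and x: "x \<in> carrier G"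
  shows "f x = x"
proof -
  have "bij_betw f (carrier G) (carrier G)"
    using f g gf fg by (intro bij_betw_byWitness[where f' = g]) (auto simp: hom_def)
  then have "restrict f (carrier G) \<in> Bij (carrier G)"
    by (simp add: Bij_def bij_betw_restrict_eq)
  moreover have "restrict f (carrier G) \<in> hom G G"
    using f by (auto simp: hom_def)
  ultimately have "restrict f (carrier G) = (\<lambda>x \<in> carrier G. x)"
    using rigid by (simp add: determining_set_def auto_def)
  then show ?thesis using x by (metis restrict_apply')
qed

lemma (in group) rigid_imp_commute:
  assumes rigid: "determining_set G {}" and a: "a \<in> carrier G" and x: "x \<in> carrier G"
  shows "a \<otimes> x = x \<otimes> a"
proof -
  have cancel: "inv a \<otimes> (a \<otimes> y) = y" "a \<otimes> (inv a \<otimes> y) = y" if "y \<in> carrier G" for y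
    using a that by (simp_all flip: m_assoc)
  have "a \<otimes> x \<otimes> inv a = x"
  proof (rule rigid_imp_fixes[OF rigid, where g = "\<lambda>y. inv a \<otimes> y \<otimes> a"])
    show "(\<lambda>y. a \<otimes> y \<otimes> inv a) \<in> hom G G"
      using a cancel by (intro homI) (simp_all add: m_assoc)
  qed (use a x cancel in \<open>simp_all add: m_assoc\<close>)
  then show ?thesis
    using a x by (metis inv_solve_right m_closed)
qed

lemma (in comm_group) rigid_imp_square_one:
  assumes rigid: "determining_set G {}" and x: "x \<in> carrier G"
  shows "x \<otimes> x = \<one>"
proof -
  have "inv x = x"
    by (rule rigid_imp_fixes[OF rigid, where g = "m_inv G"])
      (use x in \<open>auto simp: inv_mult intro: homI\<close>)
  then show ?thesis using x by (metis r_inv)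
qed

lemma (in group) exists_maximal_proper_subgroup:
  assumes fin: "finite (carrier G)" and nontriv: "carrier G \<noteq> {\<one>}"
  obtains H where "subgroup H G" "H \<noteq> carrier G"
    "\<And>K. \<lbrakk>subgroup K G; H \<subseteq> K; K \<noteq> carrier G\<rbrakk> \<Longrightarrow> K = H"
proof -
  let ?P = "{H. subgroup H G \<and> H \<noteq> carrier G}"
  have "?P \<subseteq> Pow (carrier G)" by (auto dest: subgroup.subset)
  then have "finite ?P" using fin by (meson finite_Pow_iff finite_subset)
  moreover have "{\<one>} \<in> ?P" using nontriv by (auto intro: triv_subgroup)
  ultimately have "\<exists>H\<in>?P. \<forall>K\<in>?P. H \<subseteq> K \<longrightarrow> H = K"
    by (intro finite_has_maximal) blast+
  then show thesis using that by blast
qed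

text \<open>
  In exponent \<open>2\<close> a maximal subgroup has index \<open>2\<close>: for \<open>a\<close> outside \<open>H\<close> the union of
  \<open>H\<close> and its coset by \<open>a\<close> is already closed under multiplication, since
  \<open>a \<otimes> a = \<one>\<close>, and so it is everything.
\<close>

lemma (in comm_group) maximal_subgroup_index_two:
  assumes square: "\<And>x. x \<in> carrier G \<Longrightarrow> x \<otimes> x = \<one>"
    and H: "subgroup H G"
    and maximal: "\<And>K. \<lbrakk>subgroup K G; H \<subseteq> K; K \<noteq> carrier G\<rbrakk> \<Longrightarrow> K = H"
    and a: "a \<in> carrier G" "a \<notin> H"
  shows "carrier G = H \<union> (\<lambda>h. a \<otimes> h) ` H"
proof -
  interpret H: subgroup H G by (rule H)
  let ?K = "H \<union> (\<lambda>h. a \<otimes> h) ` H"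
  have inv_self: "inv x = x" if "x \<in> carrier G" for x
    using square that by (simp add: inv_equality)
  have aa: "a \<otimes> (a \<otimes> y) = y" if "y \<in> carrier G" for y
    using a square that by (simp flip: m_assoc)
  have "subgroup ?K G"
  proof (rule subgroupI)
    show sub: "?K \<subseteq> carrier G" using a by auto
    show "?K \<noteq> {}" using H.one_closed by blast
    show "inv x \<in> ?K" if "x \<in> ?K" for x
    proof -
      have "inv x = x" using that sub by (intro inv_self) blast
      then show ?thesis using that by simp
    qed
    fix x y assume xy: "x \<in> ?K" "y \<in> ?K"
    then obtain h k where hk: "h \<in> H" "k \<in> H"
      and x: "x = h \<or> x = a \<otimes> h" and y: "y = k \<or> y = a \<otimes> k" by blast
    have "x \<otimes> y = h \<otimes> k \<or> x \<otimes> y = a \<otimes> (h \<otimes> k)"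
      using x y hk a(1) aa[of "h \<otimes> k"] by (auto simp: m_ac)
    then show "x \<otimes> y \<in> ?K"
      using H.m_closed[OF hk] imageI[OF H.m_closed[OF hk], of "\<lambda>h. a \<otimes> h"]
      by (elim disjE) simp_all
  qed
  moreover have "a \<in> ?K"
    using a H.one_closed by (auto intro!: image_eqI[where x = \<one>])
  ultimately show ?thesis using maximal[of ?K] a by blast
qed

text \<open>
  The transvection along \<open>h\<close> multiplies by \<open>h\<close> off \<open>H\<close> and fixes \<open>H\<close>.  It is
  multiplicative because the product of two elements off \<open>H\<close> lies in \<open>H\<close> and the two
  factors \<open>h\<close> cancel.
\<close>

lemma (in comm_group) transvection_hom:
  assumes square: "h \<otimes> h = \<one>"
    and H: "subgroup H G"
    and index: "\<And>x y. \<lbrakk>x \<in> carrier G - H; y \<in> carrier G - H\<rbrakk> \<Longrightarrow> x \<otimes> y \<in> H"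
    and h: "h \<in> H"
  shows "(\<lambda>x. if x \<in> H then x else x \<otimes> h) \<in> hom G G"
proof -
  interpret H: subgroup H G by (rule H)
  have hG: "h \<in> carrier G" using h by simp
  have hh: "h \<otimes> (h \<otimes> y) = y" if "y \<in> carrier G" for y
    using square hG that by (simp flip: m_assoc)
  have mixed: "x \<otimes> y \<notin> H" if "x \<in> H" "y \<in> carrier G - H" for x y
  proof
    assume "x \<otimes> y \<in> H"
    then have "inv x \<otimes> (x \<otimes> y) \<in> H" using that by simp
    then show False using that by (simp flip: m_assoc)
  qed
  show ?thesis
  proof (rule homI)
    fix x y assume xy: "x \<in> carrier G" "y \<in> carrier G"
    consider "x \<in> H" "y \<in> H" | "x \<in> H" "y \<notin> H" | "x \<notin> H" "y \<in> H" | "x \<notin> H" "y \<notin> H"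
      by blast
    then show "(if x \<otimes> y \<in> H then x \<otimes> y else x \<otimes> y \<otimes> h) =
        (if x \<in> H then x else x \<otimes> h) \<otimes> (if y \<in> H then y else y \<otimes> h)"
    proof cases
      case 3
      then have "x \<otimes> y \<notin> H" using mixed[of y x] xy by (simp add: m_comm)
      then show ?thesis using 3 xy hG by (simp add: m_ac)
    qed (use xy hG hh[of "x \<otimes> y"] mixed index in \<open>auto simp: m_ac\<close>)
  qed (use hG in auto)
qed

lemma (in group) rigid_imp_order_two:
  assumes rigid: "determining_set G {}"
    and fin: "finite (carrier G)" and two: "order G \<ge> 2"
  shows "order G = 2"
proof -
  interpret comm_group G
    by (rule group_comm_groupI) (rule rigid_imp_commute[OF rigid])
  note square = rigid_imp_square_one[OF rigid]
  have "carrier G \<noteq> {\<one>}" using two by (auto simp: order_def)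
  then obtain H where H: "subgroup H G" and "H \<noteq> carrier G"
    and maximal: "\<And>K. \<lbrakk>subgroup K G; H \<subseteq> K; K \<noteq> carrier G\<rbrakk> \<Longrightarrow> K = H"
    using exists_maximal_proper_subgroup[OF fin] by blast
  interpret H: subgroup H G by (rule H)
  obtain a where a: "a \<in> carrier G" "a \<notin> H"
    using \<open>H \<noteq> carrier G\<close> H.subset by blast
  have cover: "carrier G = H \<union> (\<lambda>h. b \<otimes> h) ` H" if "b \<in> carrier G - H" for b
    using maximal_subgroup_index_two[OF square H maximal] that by blast
  have index: "x \<otimes> y \<in> H" if x: "x \<in> carrier G - H" and y: "y \<in> carrier G - H" for x y
  proof -
    obtain k where k: "k \<in> H" "y = x \<otimes> k" using y cover[OF x] by blast
    then have "x \<otimes> y = k" using x square by (simp flip: m_assoc)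
    then show ?thesis using k by simp
  qed
  have "h = \<one>" if h: "h \<in> H" for h
  proof -
    let ?t = "\<lambda>x. if x \<in> H then x else x \<otimes> h"
    have hG: "h \<in> carrier G" using h by simp
    have off: "x \<otimes> h \<notin> H" if "x \<in> carrier G" "x \<notin> H" for x
    proof
      assume "x \<otimes> h \<in> H"
      then have "x \<otimes> h \<otimes> h \<in> H" using h by simp
      then show False using that hG square by (simp add: m_assoc)
    qed
    have inverse: "?t (?t x) = x" if "x \<in> carrier G" for x
      using that off hG square by (simp add: m_assoc)
    have "?t a = a"
    proof (rule rigid_imp_fixes[OF rigid, where g = ?t])
      show "?t \<in> hom G G" using square[OF hG] H index h by (rule transvection_hom)
      show "?t \<in> carrier G \<rightarrow> carrier G" using hG by auto
    qed (use a inverse in auto)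
    then show "h = \<one>" using a hG by simp
  qed
  then have "H = {\<one>}" using H.one_closed by blast
  moreover have "carrier G = H \<union> (\<lambda>h. a \<otimes> h) ` H" using a by (intro cover) blast
  ultimately have "carrier G = {\<one>, a}"
    by (simp only: image_insert image_empty Un_insert_left Un_empty_left r_one[OF a(1)])
  moreover have "a \<noteq> \<one>" using a H.one_closed by blast
  ultimately show ?thesis by (simp add: order_def)
qed

lemma (in group) order_two_carrier:
  assumes "order G = 2"
  obtains a where "a \<noteq> \<one>" "carrier G = {\<one>, a}"
proof -
  obtain x y where xy: "carrier G = {x, y}" "x \<noteq> y"
    using assms unfolding order_def card_2_iff by blast
  then consider "\<one> = x" | "\<one> = y" using one_closed by blast
  then show thesis
  proof cases
    case 1
    then show thesis using xy by (intro that[of y]) auto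
  next
    case 2
    then show thesis using xy by (intro that[of x]) auto
  qed
qed

lemma (in group) order_two_imp_cyclic:
  assumes "order G = 2"
  shows "cyclic_group G"
proof -
  obtain a where c: "carrier G = {\<one>, a}" using order_two_carrier[OF assms] by blast
  then have a: "a \<in> carrier G" by simp
  have "{\<one>, a} \<subseteq> range (\<lambda>n::int. a [^] n)"
    using a by (auto intro: range_eqI[where x = "0::int"] range_eqI[where x = "1::int"])
  moreover have "range (\<lambda>n::int. a [^] n) \<subseteq> carrier G" using a by auto
  ultimately show ?thesis using a c unfolding cyclic_group by blast
qed

lemma (in group) order_two_imp_rigid:
  assumes "order G = 2"
  shows "determining_set G {}"
  unfolding determining_set_def
proof (intro conjI ballI impI)
  fix f assume f: "f \<in> auto G"
  obtain a where a: "a \<noteq> \<one>" "carrier G = {\<one>, a}"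
    using order_two_carrier[OF assms] by blast
  have one: "f \<one> = \<one>" using f is_group by (auto simp: auto_def intro: hom_one)
  moreover have "f a = a"
  proof -
    have "f a \<in> {\<one>, a}" "f a \<noteq> f \<one>"
      using f a by (auto simp: auto_def Bij_def bij_betw_def inj_on_def)
    then show ?thesis using one by simp
  qed
  ultimately show "f = (\<lambda>x \<in> carrier G. x)"
    using f a(2) by (intro extensionalityI[where A = "carrier G"]) (auto simp: auto_def Bij_def)
qed simp

theorem theorem4p1:
  fixes G :: "('a, 'b) monoid_scheme"
  assumes "group G" and "finite (carrier G)" and "order G \<ge> 2"
  shows "determining_number G = 0 \<longleftrightarrow> cyclic_group G \<and> order G = 2"
proof -
  interpret group G by (rule assms(1))
  show ?thesis
    unfolding determining_number_eq_0_iff[OF assms(2)]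
    using rigid_imp_order_two[OF _ assms(2,3)] order_two_imp_cyclic order_two_imp_rigid
    by blast
qed

end
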